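(* Let $H$ and $U$ be (real) Hilbert spaces, let $A$ be the generator of an analytic semigroup on $H$, let $B\in\mathcal{L}(U;H)$, and let $T>0$. Let $K\in\mathbb{N}$, let $(\mu_k)_{k\in\{1,\dots,K\}}$ be a family of pairwise distinct real numbers, and let $(\mathcal{W}_k)_{k\in\{1,\dots,K\}}$ be a family of closed vector subspaces of $H$ such that, for each $k$, $$\text{any } z\in\mathcal{D}(A^* ) \text{ satisfying } (\mu_k+A^* )z\in\mathcal{W}_k \text{ and } B^*z=0 \text{ vanishes identically},$$ and set $$\mathcal{W}=\mathrm{Span}\{e^{\mu_kt}w_k:\ k\in\{1,\dots,K\},\ w_k\in\mathcal{W}_k\}\subset L^2(0,T;H).$$ Let $J\in\mathbb{N}$, let $(\rho_j)_{j\in\{1,\dots,J\}}$ be a family of pairwise distinct real numbers, and let $(\mathcal{G}_j)_{j\in\{1,\dots,J\}}$ be a family of closed vector subspaces of $U$ such that, for each $j$, $$\text{any } z\in\mathcal{D}(A^* ) \text{ satisfying } (\rho_j+A^* )z=0 \text{ and } B^*z\in\mathcal{G}_j \text{ vanishes identically},$$ and set $$\mathcal{G}=\mathrm{Span}\{e^{\rho_jt}g_j:\ j\in\{1,\dots,J\},\ g_j\in\mathcal{G}_j\}\subset L^2(0,T;U).$$ Assume also that $\{\mu_k:\ k\in\{1,\dots,K\}\}\cap\{\rho_j:\ j\in\{1,\dots,J\}\}=\emptyset$. Finally, assume the classical unique continuation property: if $z\in C^0([0,T];H)$ satisfies $z'+A^*z=0$ for $t\in(0,T)$, $z(T)=z_T$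 with $z_T\in H$, and $B^*z=0$ for $t\in(0,T)$, then $z_T=0$. Then the following unique continuation property holds: if, for some $(z_T,g,w)\in H\times\mathcal{G}\times\mathcal{W}$, the solution $z$ of $z'+A^*z=w$ for $t\in(0,T)$, $z(T)=z_T$, satisfies $B^*z=g$ for $t\in(0,T)$, then $z_T=0$, $g=0$ and $w=0$.
   Context: $e^{\mu_kt}w_k$ denotes the function $t\in(0,T)\mapsto e^{\mu_kt}w_k\in H$, and similarly for $e^{\rho_jt}g_j$. Solutions of the evolution equations are the usual mild (semigroup) solutions, which belong to $C^0([0,T];H)$; the equation for $z$ is solved backward in time from $z(T)=z_T$. $A^*$, $B^*$ denote adjoints and $\mathcal{D}(A^* )$ is the domain of $A^*$. *)

theory Defs
  imports "HOL-Analysis.Analysis" "HOL-Library.Function_Algebras"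
begin

text \<open>
  Real Hilbert spaces are types of sort \<open>{real_inner, banach}\<close>.  An unbounded operator on
  such a space is a partial function \<open>A :: 'h \<rightharpoonup> 'h\<close>, with domain \<open>dom A\<close> and
  value \<open>the (A x)\<close> at \<open>x \<in> dom A\<close>.
\<close>

definition c0_semigroup :: "(real \<Rightarrow> 'a::banach \<Rightarrow>\<^sub>L 'a) \<Rightarrow> bool" where
  "c0_semigroup S \<longleftrightarrow>
     S 0 = id_blinfun \<and>
     (\<forall>s\<ge>0. \<forall>t\<ge>0. S (s + t) = S s o\<^sub>L S t) \<and>
     (\<forall>x. ((\<lambda>t. blinfun_apply (S t) x) \<longlongrightarrow> x) (at_right 0))"

definition generator :: "(real \<Rightarrow> 'a::banach \<Rightarrow>\<^sub>L 'a) \<Rightarrow> ('a \<rightharpoonup> 'a)" where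
  "generator S = (\<lambda>x.
     if \<exists>y. ((\<lambda>h. (blinfun_apply (S h) x - x) /\<^sub>R h) \<longlongrightarrow> y) (at_right 0)
     then Some (Lim (at_right 0) (\<lambda>h. (blinfun_apply (S h) x - x) /\<^sub>R h))
     else None)"

text \<open>
  Analyticity of a semigroup on a real space refers to its complexification.  The
  complexification of \<open>'a\<close> is \<open>'a \<times> 'a\<close>, the pair \<open>(x, y)\<close> standing for \<open>x + i y\<close>.  The
  product norm is the Hilbert norm of the complexification.
\<close>

definition cscale :: "complex \<Rightarrow> 'a::real_vector \<times> 'a \<Rightarrow> 'a \<times> 'a" where
  "cscale c v = (Re c *\<^sub>R fst v - Im c *\<^sub>R snd v, Re c *\<^sub>R snd v + Im c *\<^sub>R fst v)"

definition sector :: "real \<Rightarrow> complex set" where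
  "sector \<theta> = {z. z \<noteq> 0 \<and> \<bar>Arg z\<bar> < \<theta>}"

text \<open>
  The condition \<open>D c v = cscale c (D 1 v)\<close> says that the real Frechet derivative \<open>D\<close> of the
  operator-valued map \<open>E\<close> at \<open>z\<close> is complex linear, that is, \<open>E\<close> is complex differentiable
  at \<open>z\<close> in operator norm.
\<close>

definition analytic_semigroup :: "(real \<Rightarrow> 'a::{real_inner,banach} \<Rightarrow>\<^sub>L 'a) \<Rightarrow> bool" where
  "analytic_semigroup S \<longleftrightarrow>
     c0_semigroup S \<and>
     (\<exists>\<theta> (E :: complex \<Rightarrow> ('a \<times> 'a) \<Rightarrow>\<^sub>L ('a \<times> 'a)).
        0 < \<theta> \<and> \<theta> \<le> pi / 2 \<and>
        (\<forall>t>0. \<forall>x y. blinfun_apply (E (complex_of_real t)) (x, y) =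
                       (blinfun_apply (S t) x, blinfun_apply (S t) y)) \<and>
        (\<forall>z\<in>sector \<theta>. \<forall>c v. blinfun_apply (E z) (cscale c v) = cscale c (blinfun_apply (E z) v)) \<and>
        (\<forall>z\<in>sector \<theta>. \<forall>z'\<in>sector \<theta>. E (z + z') = E z o\<^sub>L E z') \<and>
        (\<forall>z\<in>sector \<theta>. \<exists>D. (E has_derivative D) (at z) \<and>
            (\<forall>c v. blinfun_apply (D c) v = cscale c (blinfun_apply (D 1) v))) \<and>
        (\<forall>v. ((\<lambda>z. blinfun_apply (E z) v) \<longlongrightarrow> v) (at 0 within sector \<theta>)))"

definition generates_analytic_semigroup :: "('a::{real_inner,banach} \<rightharpoonup> 'a) \<Rightarrow> bool" where
  "generates_analytic_semigroup A \<longleftrightarrow> (\<exists>S. analytic_semigroup S \<and> generator S = A)"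

text \<open>
  Meaningful for densely defined \<open>A\<close> (in particular for generators), where the vector \<open>y\<close>
  below is unique.  Adjoints of bounded operators are the library's \<open>adjoint\<close>.
\<close>

definition adjoint_op :: "('a::real_inner \<rightharpoonup> 'a) \<Rightarrow> ('a \<rightharpoonup> 'a)" where
  "adjoint_op A = (\<lambda>z.
     if \<exists>y. \<forall>x\<in>dom A. the (A x) \<bullet> z = x \<bullet> y
     then Some (THE y. \<forall>x\<in>dom A. the (A x) \<bullet> z = x \<bullet> y)
     else None)"

text \<open>
  \<open>z\<close> is the mild solution on \<open>[0, T]\<close> of \<open>z' + L z = w\<close>, \<open>z(T) = zT\<close>, where \<open>L\<close> generates the
  strongly continuous semigroup \<open>R\<close>:
  \<open>z(t) = R(T - t) zT - \<integral>\<^sub>t\<^sup>T R(s - t) w(s) ds\<close>.  The semigroup \<open>R\<close> is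
  determined by \<open>L\<close>; the case \<open>t = T\<close> of the formula is the terminal condition.
\<close>

definition backward_mild_solution ::
  "('a::banach \<rightharpoonup> 'a) \<Rightarrow> real \<Rightarrow> 'a \<Rightarrow> (real \<Rightarrow> 'a) \<Rightarrow> (real \<Rightarrow> 'a) \<Rightarrow> bool" where
  "backward_mild_solution L T zT w z \<longleftrightarrow>
     (\<exists>R. c0_semigroup R \<and> generator R = L \<and>
        continuous_on {0..T} z \<and>
        (\<forall>t\<in>{0..T}. ((\<lambda>s. blinfun_apply (R (s - t)) (w s))
            has_integral (blinfun_apply (R (T - t)) zT - z t)) {t..T}))"

text \<open>
  Functions on \<open>(0, T)\<close> are extended by zero to the real line.  All elements of the span below
  are continuous on \<open>(0, T)\<close> and bounded, so they represent elements of \<open>L\<^sup>2(0,T)\<close>, and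
  two of them agree almost everywhere only if they are equal as functions.
\<close>

definition exp_fun :: "real \<Rightarrow> real \<Rightarrow> 'a::real_normed_vector \<Rightarrow> real \<Rightarrow> 'a" where
  "exp_fun T m v = (\<lambda>t. if t \<in> {0<..<T} then exp (m * t) *\<^sub>R v else 0)"

definition scale_fun :: "real \<Rightarrow> (real \<Rightarrow> 'a::real_vector) \<Rightarrow> real \<Rightarrow> 'a" where
  "scale_fun c f = (\<lambda>t. c *\<^sub>R f t)"

lemma module_scale_fun: "module (scale_fun :: real \<Rightarrow> (real \<Rightarrow> 'a::real_vector) \<Rightarrow> real \<Rightarrow> 'a)"
  by unfold_locales (auto simp: scale_fun_def fun_eq_iff algebra_simps)

definition exp_span ::
  "real \<Rightarrow> nat \<Rightarrow> (nat \<Rightarrow> real) \<Rightarrow> (nat \<Rightarrow> 'a::real_normed_vector set) \<Rightarrow> (real \<Rightarrow> 'a) set" where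
  "exp_span T N m V = module.span scale_fun {exp_fun T (m k) v |k v. k \<in> {1..N} \<and> v \<in> V k}"

end

theory Submission imports Defs "HOL-Complex_Analysis.Complex_Analysis" begin

text \<open>
  Let \<open>R\<close> be the semigroup generated by \<open>A\<^sup>*\<close>.  The data \<open>w\<close> and \<open>g\<close> are sums of exponentials in
  time, and a mild solution is described by a formula that is linear and invariant under
  translations of time.  Hence the difference operator
  \<open>z(t) - e\<^sup>-\<^sup>m\<^sup>\<delta> z(t + \<delta>)\<close> maps solutions on \<open>[0, T]\<close> to solutions on \<open>[0, T - \<delta>]\<close>.  On the data it
  removes the exponential \<open>e\<^sup>m\<^sup>t\<close> and multiplies every other coefficient by a nonzero number.
  It takes the place of the operator \<open>d/dt - m\<close>, which would ask for differentiability of the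
  mild solution \<open>z\<close> in time.

  All exponents \<open>\<mu>\<^sub>k\<close>, \<open>\<rho>\<^sub>j\<close> are distinct, so an induction removes them one by one and leaves a
  single exponent \<open>m\<close>, with coefficients \<open>p\<close> in \<open>w\<close> and \<open>q\<close> in \<open>g\<close>
  (\<open>exponential_sum_vanishes\<close>).  There the difference solves the homogeneous equation and is
  invisible to \<open>B\<^sup>*\<close>, hence it vanishes for every \<open>\<delta> < T\<close>.  This forces
  \<open>z(t) = e\<^sup>m\<^sup>t a\<close> for a fixed vector \<open>a\<close>, and the equation becomes
  \<open>(m + A\<^sup>*) a = p\<close>, \<open>B\<^sup>* a = q\<close> (\<open>single_exponential_vanishes\<close>).  The two stationary hypotheses
  give \<open>a = 0\<close>: in the case \<open>m = \<mu>\<^sub>k\<close> we have \<open>p \<in> W\<^sub>k\<close> and \<open>q = 0\<close>, in the case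
  \<open>m = \<rho>\<^sub>j\<close> we have \<open>p = 0\<close> and \<open>q \<in> G\<^sub>j\<close>.  So all coefficients vanish, and the classical unique
  continuation property gives \<open>z\<^sub>T = 0\<close>.

  Differences shorten the time interval, so unique continuation is needed on intervals shorter
  than \<open>[0, T]\<close>.  Here analyticity enters: if \<open>S\<close> is the semigroup of \<open>A\<close>, then
  \<open>\<langle>u, B\<^sup>* R(t) y\<rangle> = \<langle>S(t) B u, y\<rangle>\<close> is an analytic function of \<open>t > 0\<close>, and it vanishes everywhere
  once it vanishes on some interval (\<open>unique_continuation_short_time\<close>).  The identity uses that \<open>R\<close>,
  known only through its generator, consists of the adjoints of \<open>S\<close>
  (\<open>adjoint_generator_semigroup\<close>).
\<close>

section \<open>Adjoints of bounded operators\<close>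

text \<open>
  The representing vector is the minimiser of \<open>\<parallel>v\<parallel>\<^sup>2 / 2 - f v\<close>: by the parallelogram law every
  minimising sequence is Cauchy, and at the minimum the derivative \<open>\<langle>v, x\<rangle> - f x\<close> in each direction
  \<open>x\<close> is zero.
\<close>

lemma riesz_representation:
  fixes f :: "'u::{real_inner,banach} \<Rightarrow> real"
  assumes "bounded_linear f"
  shows "\<exists>v. \<forall>x. f x = x \<bullet> v"
proof -
  interpret f: bounded_linear f by fact
  define J where "J v = (norm v)\<^sup>2 / 2 - f v" for v
  obtain M where M: "\<And>x. norm (f x) \<le> norm x * M" using f.bounded by blast
  have low: "- (M\<^sup>2 / 2) \<le> J v" for v
  proof -
    have "f v \<le> norm v * M" using M[of v] by simp
    moreover have "0 \<le> (norm v - M)\<^sup>2" by simp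
    ultimately show ?thesis unfolding J_def by (simp add: power2_diff)
  qed
  define m where "m = Inf (range J)"
  have bdd: "bdd_below (range J)" using low by (auto intro!: bdd_belowI2[where m="- (M\<^sup>2 / 2)"])
  have m_le: "m \<le> J v" for v unfolding m_def using bdd by (intro cInf_lower) auto
  have "\<exists>v. J v < m + inverse (real (Suc n))" for n
  proof -
    have "Inf (range J) < m + inverse (real (Suc n))" unfolding m_def by simp
    then show ?thesis using cInf_lessD[of "range J"] by blast
  qed
  then obtain X where X: "\<And>n. J (X n) < m + inverse (real (Suc n))" by metis
  have parallelogram: "(norm (a - b))\<^sup>2 \<le> 4 * (J a + J b - 2 * m)" for a b
  proof -
    have "J a + J b - 2 * J ((1/2) *\<^sub>R (a + b)) = (norm (a - b))\<^sup>2 / 4"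
      unfolding J_def power2_norm_eq_inner
      by (simp add: f.scaleR f.add inner_add_left inner_add_right inner_diff_left inner_diff_right
          inner_commute field_simps)
    with m_le[of "(1/2) *\<^sub>R (a + b)"] show ?thesis by simp
  qed
  have "Cauchy X"
  proof (rule metric_CauchyI)
    fix e :: real assume e: "e > 0"
    then obtain N where N: "inverse (real (Suc N)) < e\<^sup>2 / 8"
      using reals_Archimedean[of "e\<^sup>2 / 8"] by auto
    have "dist (X k) (X l) < e" if "k \<ge> N" "l \<ge> N" for k l
    proof -
      have "inverse (real (Suc k)) \<le> inverse (real (Suc N))"
        "inverse (real (Suc l)) \<le> inverse (real (Suc N))" using that by (auto intro!: le_imp_inverse_le)
      with X[of k] X[of l] N have "J (X k) + J (X l) - 2 * m < e\<^sup>2 / 4" by linarith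
      then have "4 * (J (X k) + J (X l) - 2 * m) < e\<^sup>2" by simp
      with parallelogram[of "X k" "X l"] have "(norm (X k - X l))\<^sup>2 < e\<^sup>2"
        by (rule order.strict_trans1)
      then show ?thesis using e by (simp add: dist_norm power_less_imp_less_base)
    qed
    then show "\<exists>M. \<forall>m\<ge>M. \<forall>n\<ge>M. dist (X m) (X n) < e" by blast
  qed
  then obtain v where v: "X \<longlonglongrightarrow> v" by (meson Cauchy_convergent convergent_def)
  have "(\<lambda>n. J (X n)) \<longlonglongrightarrow> J v"
    unfolding J_def by (intro tendsto_intros f.tendsto v) auto
  moreover have "(\<lambda>n. m + inverse (real (Suc n))) \<longlonglongrightarrow> m + 0"
    by (intro tendsto_intros LIMSEQ_inverse_real_of_nat)
  ultimately have "J v \<le> m + 0"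
    by (rule LIMSEQ_le) (use X less_imp_le in blast)
  then have min: "J v \<le> J u" for u using m_le[of u] by simp
  have "f x = x \<bullet> v" for x
  proof (cases "x = 0")
    case False
    define c where "c = x \<bullet> v - f x"
    \<comment> \<open>the minimiser of the parabola \<open>t \<mapsto> J (v + t x)\<close>\<close>
    define t where "t = - (c / (x \<bullet> x))"
    have "J (v + t *\<^sub>R x) - J v = t * c + t\<^sup>2 * (x \<bullet> x) / 2"
      unfolding J_def c_def power2_norm_eq_inner
      by (simp add: f.scaleR f.add inner_add_left inner_add_right inner_commute
          power2_eq_square field_simps)
    also have "\<dots> = - (c\<^sup>2 / (x \<bullet> x) / 2)"
      using False by (simp add: t_def power2_eq_square field_simps)
    finally have "c\<^sup>2 / (x \<bullet> x) \<le> 0" using min[of "v + t *\<^sub>R x"] by simp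
    moreover have "x \<bullet> x > 0" using False by simp
    ultimately have "c\<^sup>2 \<le> 0" by (simp add: divide_le_0_iff)
    then show ?thesis by (simp add: c_def)
  qed (simp add: f.zero)
  then show ?thesis by blast
qed

text \<open>
  The constant \<open>adjoint\<close> is defined by choice; on an infinite-dimensional space the existence of
  the adjoint that justifies the choice is the Riesz representation of \<open>x \<mapsto> \<langle>B x, y\<rangle>\<close>.
\<close>

lemma inner_adjoint_blinfun:
  fixes B :: "'u::{real_inner,banach} \<Rightarrow>\<^sub>L 'h::real_inner"
  shows "x \<bullet> adjoint (blinfun_apply B) y = blinfun_apply B x \<bullet> y"
proof -
  have "\<exists>v. \<forall>x. blinfun_apply B x \<bullet> y = x \<bullet> v" for y
    by (intro riesz_representation bounded_linear_inner_left_comp blinfun.bounded_linear_right)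
  then obtain B' where B': "\<And>x y. blinfun_apply B x \<bullet> y = x \<bullet> B' y" by metis
  then have "adjoint (blinfun_apply B) = B'" by (intro adjoint_unique) auto
  with B' show ?thesis by simp
qed

lemma linear_adjoint_blinfun:
  fixes B :: "'u::{real_inner,banach} \<Rightarrow>\<^sub>L 'h::real_inner"
  shows "linear (adjoint (blinfun_apply B))"
  by (rule linearI; rule vector_eq_ldot[THEN iffD1])
     (simp_all add: inner_adjoint_blinfun inner_add_right)

section \<open>Strongly continuous semigroups\<close>

text \<open>
  By the Baire category theorem one of the closed sets on which all operators are bounded by a
  common \<open>m\<close> contains a ball, and linearity spreads the bound from that ball.
\<close>

lemma banach_steinhaus_sequence:
  fixes F :: "nat \<Rightarrow> 'a::banach \<Rightarrow>\<^sub>L 'b::real_normed_vector"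
  assumes "\<And>x. Bseq (\<lambda>n. blinfun_apply (F n) x)"
  shows "\<exists>M. \<forall>n. norm (F n) \<le> M"
proof -
  define C where "C m = (\<Inter>n. {x. norm (blinfun_apply (F n) x) \<le> real m})" for m :: nat
  have closed: "closed (C m)" for m
    unfolding C_def by (intro closed_INT ballI closed_Collect_le continuous_intros)
  have cover: "\<Union>(range C) = UNIV"
  proof (intro equalityI subset_UNIV subsetI)
    fix x
    obtain c where "\<And>n. norm (blinfun_apply (F n) x) \<le> c"
      using assms[of x] unfolding Bseq_def by auto
    moreover obtain m where "c \<le> real m" using real_arch_simple by blast
    ultimately have "x \<in> C m" unfolding C_def by (auto intro: order_trans)
    then show "x \<in> \<Union>(range C)" by blast
  qed
  have "\<exists>m. interior (C m) \<noteq> {}"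
  proof (rule ccontr)
    assume "\<not> ?thesis"
    then have "Met_TC.mtopology interior_of \<Union>(range C) = {}"
      by (intro Met_TC.metric_Baire_category_alt)
         (use closed complete_UNIV in auto)
    then show False using cover by simp
  qed
  then obtain m x r where r: "r > 0" "ball x r \<subseteq> C m"
    by (metis equals0I interior_subset mem_interior ex_in_conv)
  have "norm (F n) \<le> 4 * real m / r" for n
  proof (rule norm_blinfun_bound)
    show "0 \<le> 4 * real m / r" using r by simp
    fix y
    show "norm (blinfun_apply (F n) y) \<le> 4 * real m / r * norm y"
    proof (cases "y = 0")
      case False
      define s where "s = r / (2 * norm y)"
      have s: "s > 0" "norm (s *\<^sub>R y) < r" using r False by (auto simp: s_def)
      then have "x + s *\<^sub>R y \<in> C m" "x \<in> C m" using r by (auto simp: dist_norm)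
      then have "norm (blinfun_apply (F n) (x + s *\<^sub>R y)) \<le> m" "norm (blinfun_apply (F n) x) \<le> m"
        unfolding C_def by auto
      then have "norm (blinfun_apply (F n) (x + s *\<^sub>R y) - blinfun_apply (F n) x) \<le> 2 * m"
        using norm_triangle_ineq4[of "blinfun_apply (F n) (x + s *\<^sub>R y)" "blinfun_apply (F n) x"]
        by linarith
      then have "s * norm (blinfun_apply (F n) y) \<le> 2 * m"
        using s by (simp add: blinfun.add_right blinfun.scaleR_right)
      then show ?thesis using s r False by (simp add: s_def field_simps)
    qed simp
  qed
  then show ?thesis by blast
qed

lemma c0_semigroup_zero:
  "c0_semigroup S \<Longrightarrow> blinfun_apply (S 0) x = x"
  by (simp add: c0_semigroup_def)

lemma c0_semigroup_add:
  "\<lbrakk>c0_semigroup S; 0 \<le> s; 0 \<le> t\<rbrakk> \<Longrightarrow>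
    blinfun_apply (S (s + t)) x = blinfun_apply (S s) (blinfun_apply (S t) x)"
  by (simp add: c0_semigroup_def)

lemma c0_semigroup_commute:
  "\<lbrakk>c0_semigroup S; 0 \<le> s; 0 \<le> t\<rbrakk> \<Longrightarrow>
    blinfun_apply (S s) (blinfun_apply (S t) x) = blinfun_apply (S t) (blinfun_apply (S s) x)"
  by (metis c0_semigroup_add add.commute)

lemma c0_semigroup_tendsto:
  "c0_semigroup S \<Longrightarrow> ((\<lambda>t. blinfun_apply (S t) x) \<longlongrightarrow> x) (at_right 0)"
  by (simp add: c0_semigroup_def)

text \<open>
  If the norms were unbounded near \<open>0\<close>, they would be unbounded along some \<open>t\<^sub>n \<down> 0\<close>, although
  \<open>S(t\<^sub>n) x\<close> converges for each \<open>x\<close>; this contradicts the uniform boundedness principle.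
\<close>

lemma c0_semigroup_bounded_near_0:
  assumes S: "c0_semigroup S"
  shows "\<exists>d>0. \<exists>M. \<forall>t\<in>{0..d}. norm (S t) \<le> M"
proof (rule ccontr)
  assume neg: "\<not> ?thesis"
  have "\<exists>t\<in>{0..inverse (real (Suc n))}. real (Suc n) < norm (S t)" for n
    using neg by (meson inverse_positive_iff_positive not_le of_nat_0_less_iff zero_less_Suc)
  then obtain t where t: "\<And>n. t n \<in> {0..inverse (real (Suc n))}"
    "\<And>n. real (Suc n) < norm (S (t n))" by metis
  have "norm (S 0) \<le> 1" using S norm_blinfun_id_le by (simp add: c0_semigroup_def)
  then have pos: "t n > 0" for n
    using t(1)[of n] t(2)[of n] by (cases "t n = 0") auto
  have "t \<longlonglongrightarrow> 0"
    by (rule tendsto_sandwich[OF _ _ tendsto_const LIMSEQ_inverse_real_of_nat]) (use t in auto)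
  then have lim: "filterlim t (at_right 0) sequentially"
    using pos by (auto simp: filterlim_at less_imp_neq[THEN not_sym])
  have "Bseq (\<lambda>n. blinfun_apply (S (t n)) x)" for x
    using filterlim_compose[OF c0_semigroup_tendsto[OF S, of x] lim]
    by (intro convergent_imp_Bseq convergentI)
  then obtain M where M: "\<And>n. norm (S (t n)) \<le> M"
    using banach_steinhaus_sequence[of "\<lambda>n. S (t n)"] by blast
  obtain n where "M < real (Suc n)" using reals_Archimedean2[of M] by (metis less_SucI of_nat_less_iff lessI order_less_trans)
  with M[of n] t(2)[of n] show False by simp
qed

lemma c0_semigroup_bounded:
  assumes S: "c0_semigroup S"
  obtains M where "M \<ge> 1" "\<And>t. t \<in> {0..b} \<Longrightarrow> norm (S t) \<le> M"
proof -
  obtain d M0 where d: "d > 0" and M0: "\<And>t. t \<in> {0..d} \<Longrightarrow> norm (S t) \<le> M0"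
    using c0_semigroup_bounded_near_0[OF S] by blast
  define M where "M = max 1 M0"
  have M: "M \<ge> 1" "\<And>t. t \<in> {0..d} \<Longrightarrow> norm (S t) \<le> M"
    using M0 by (auto simp: M_def le_max_iff_disj)
  have step: "\<forall>t\<in>{0..real (Suc n) * d}. norm (S t) \<le> M ^ Suc n" for n
  proof (induction n)
    case 0
    then show ?case using M by simp
  next
    case (Suc n)
    show ?case
    proof
      fix t assume t: "t \<in> {0..real (Suc (Suc n)) * d}"
      show "norm (S t) \<le> M ^ Suc (Suc n)"
      proof (cases "t \<le> d")
        case True
        have "M ^ 1 \<le> M ^ Suc (Suc n)" using M(1) by (intro power_increasing) auto
        then show ?thesis using True t M(2)[of t] by auto
      next
        case False
        have "S t = S (d + (t - d))" by simp
        also have "\<dots> = S d o\<^sub>L S (t - d)" using S False d unfolding c0_semigroup_def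
          by (metis diff_ge_0_iff_ge less_imp_le not_le)
        finally have "norm (S t) \<le> norm (S d) * norm (S (t - d))"
          by (metis norm_blinfun_compose)
        also have "\<dots> \<le> M * M ^ Suc n"
          using M d Suc.IH t False by (intro mult_mono) (auto simp: algebra_simps)
        finally show ?thesis by simp
      qed
    qed
  qed
  obtain n where "b / d \<le> real n" using real_arch_simple by blast
  then have "b \<le> real (Suc n) * d" using d by (simp add: field_simps)
  then show ?thesis using step[of n] M(1) by (intro that[of "M ^ Suc n"]) (auto simp: one_le_power simp del: power_Suc of_nat_Suc)
qed

text \<open>
  The definition gives right continuity at \<open>0\<close> only.  Since
  \<open>S(v) x - S(u) x = S(u) (S(v - u) x - x)\<close> for \<open>u < v\<close>, the local bound of the norms turns it into
  continuity from both sides at every time.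
\<close>

lemma c0_semigroup_continuous_on:
  assumes S: "c0_semigroup S"
  shows "continuous_on {0..} (\<lambda>t. blinfun_apply (S t) x)"
proof -
  have "continuous_on {0..b} (\<lambda>t. blinfun_apply (S t) x)" for b
    unfolding continuous_on_iff
  proof (intro ballI allI impI)
    fix t e :: real assume t: "t \<in> {0..b}" and e: "e > 0"
    obtain M where M: "M \<ge> 1" "\<And>t. t \<in> {0..b} \<Longrightarrow> norm (S t) \<le> M"
      using c0_semigroup_bounded[OF S] by blast
    have "\<forall>\<^sub>F h in at_right 0. dist (blinfun_apply (S h) x) x < e / M"
      using c0_semigroup_tendsto[OF S] e M by (intro tendstoD) auto
    then obtain d where d: "d > 0" "\<And>h. 0 < h \<Longrightarrow> h < d \<Longrightarrow> dist (blinfun_apply (S h) x) x < e / M"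
      unfolding eventually_at_right_field by auto
    have main: "norm (blinfun_apply (S v) x - blinfun_apply (S u) x) < e"
      if "0 \<le> u" "u < v" "v \<le> b" "v - u < d" for u v
    proof -
      have "blinfun_apply (S v) x = blinfun_apply (S u) (blinfun_apply (S (v - u)) x)"
        using c0_semigroup_add[OF S, of u "v - u" x] that by simp
      then have "norm (blinfun_apply (S v) x - blinfun_apply (S u) x)
          = norm (blinfun_apply (S u) (blinfun_apply (S (v - u)) x - x))"
        by (simp add: blinfun.diff_right)
      also have "\<dots> \<le> norm (S u) * norm (blinfun_apply (S (v - u)) x - x)"
        by (rule norm_blinfun)
      also have "\<dots> \<le> M * norm (blinfun_apply (S (v - u)) x - x)"
        using M(2)[of u] that by (intro mult_right_mono) auto
      also have "\<dots> < M * (e / M)"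
        using d(2)[of "v - u"] that M by (intro mult_strict_left_mono) (auto simp: dist_norm)
      finally show ?thesis using M by simp
    qed
    show "\<exists>d>0. \<forall>s\<in>{0..b}. dist s t < d \<longrightarrow> dist (blinfun_apply (S s) x) (blinfun_apply (S t) x) < e"
    proof (intro exI[of _ d] conjI ballI impI d(1))
      fix s assume s: "s \<in> {0..b}" "dist s t < d"
      consider "s < t" | "s = t" | "t < s" by linarith
      then show "dist (blinfun_apply (S s) x) (blinfun_apply (S t) x) < e"
      proof cases
        case 1
        then show ?thesis using main[of s t] s t by (auto simp: dist_norm norm_minus_commute)
      next
        case 3
        then show ?thesis using main[of t s] s t by (auto simp: dist_norm)
      qed (use e in simp)
    qed
  qed
  then have "continuous (at t within {0..}) (\<lambda>t. blinfun_apply (S t) x)" if "t \<ge> 0" for t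
  proof -
    have "continuous (at t within {0..t+1}) (\<lambda>t. blinfun_apply (S t) x)"
      using \<open>\<And>b. continuous_on {0..b} _\<close> that by (auto simp: continuous_on_eq_continuous_within)
    moreover have "at t within {0..t+1} = at t within {0..}"
      by (rule at_within_nhd[where S="{..<t+1}"]) auto
    ultimately show ?thesis by simp
  qed
  then show ?thesis by (auto simp: continuous_on_eq_continuous_within)
qed

lemma generator_eq_Some_iff:
  "generator S x = Some y \<longleftrightarrow> ((\<lambda>h. (blinfun_apply (S h) x - x) /\<^sub>R h) \<longlongrightarrow> y) (at_right 0)"
  unfolding generator_def by (auto intro!: tendsto_Lim trivial_limit_at_right_real split: if_splits)
    (metis tendsto_Lim trivial_limit_at_right_real)

lemma generator_domain_tendsto:
  "x \<in> dom (generator S) \<Longrightarrow>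
    ((\<lambda>h. (blinfun_apply (S h) x - x) /\<^sub>R h) \<longlongrightarrow> the (generator S x)) (at_right 0)"
  using generator_eq_Some_iff by fastforce

lemma generator_commutes:
  assumes S: "c0_semigroup S" and t: "t \<ge> 0" and x: "x \<in> dom (generator S)"
  shows "generator S (blinfun_apply (S t) x) = Some (blinfun_apply (S t) (the (generator S x)))"
  unfolding generator_eq_Some_iff
proof (rule Lim_transform_eventually)
  show "((\<lambda>h. blinfun_apply (S t) ((blinfun_apply (S h) x - x) /\<^sub>R h))
      \<longlongrightarrow> blinfun_apply (S t) (the (generator S x))) (at_right 0)"
    by (intro tendsto_intros generator_domain_tendsto x)
  show "\<forall>\<^sub>F h in at_right 0. blinfun_apply (S t) ((blinfun_apply (S h) x - x) /\<^sub>R h)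
      = (blinfun_apply (S h) (blinfun_apply (S t) x) - blinfun_apply (S t) x) /\<^sub>R h"
    using eventually_at_right_less[of 0]
    by eventually_elim
       (simp add: blinfun.scaleR_right blinfun.diff_right c0_semigroup_commute[OF S _ t])
qed

text \<open>
  The derivative of an integral at the left end, in the form in which the generator is defined.
\<close>

lemma tendsto_integral_mean:
  fixes f :: "real \<Rightarrow> 'a::banach"
  assumes f: "continuous_on {a..b} f" and ab: "a < b"
  shows "((\<lambda>r. integral {a..a + r} f /\<^sub>R r) \<longlongrightarrow> f a) (at_right 0)"
proof (rule tendstoI)
  fix e :: real assume e: "e > 0"
  then obtain d where d: "d > 0" "\<And>s. s \<in> {a..b} \<Longrightarrow> dist s a < d \<Longrightarrow> dist (f s) (f a) < e / 2"
    using f ab unfolding continuous_on_iff by (metis atLeastAtMost_iff half_gt_zero less_eq_real_def)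
  have "dist (integral {a..a + r} f /\<^sub>R r) (f a) < e" if r: "0 < r" "r < min d (b - a)" for r
  proof -
    have "f integrable_on {a..a + r}"
      by (rule integrable_continuous_real, rule continuous_on_subset[OF f]) (use r in auto)
    then have "(f has_integral integral {a..a + r} f) {a..a + r}" by (rule integrable_integral)
    from has_integral_diff[OF this has_integral_const_real[of "f a" a "a + r"]]
    have "((\<lambda>s. f s - f a) has_integral integral {a..a + r} f - r *\<^sub>R f a) {a..a + r}"
      using r by simp
    then have "norm (integral {a..a + r} f - r *\<^sub>R f a) \<le> (e / 2) * Henstock_Kurzweil_Integration.content {a..a + r}"
    proof (rule has_integral_bound_real[rotated 2])
      show "norm (f s - f a) \<le> e / 2" if "s \<in> {a..a + r} - {}" for s
        using d(2)[of s] that r by (auto simp: dist_norm abs_if)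
    qed (use e in auto)
    moreover have "integral {a..a + r} f /\<^sub>R r - f a = (integral {a..a + r} f - r *\<^sub>R f a) /\<^sub>R r"
      using r by (simp add: algebra_simps)
    ultimately have "norm (integral {a..a + r} f /\<^sub>R r - f a) \<le> inverse r * ((e / 2) * r)"
      using r mult_left_mono[of "norm (integral {a..a + r} f - r *\<^sub>R f a)" "e / 2 * r" "inverse r"]
      by simp
    also have "\<dots> = e / 2"
      by (subst mult.left_commute) (use r in simp)
    finally have "norm (integral {a..a + r} f /\<^sub>R r - f a) \<le> e / 2" .
    then show ?thesis using e by (simp add: dist_norm)
  qed
  then show "\<forall>\<^sub>F r in at_right 0. dist (integral {a..a + r} f /\<^sub>R r) (f a) < e"
    unfolding eventually_at_right_field using d ab by (intro exI[of _ "min d (b - a)"]) auto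
qed

lemma has_integral_shift:
  fixes f :: "real \<Rightarrow> 'a::banach"
  assumes "(f has_integral i) {a + c..b + c}"
  shows "((\<lambda>s. f (s + c)) has_integral i) {a..b}"
  using has_integral_affinity'[of f i "a + c" "b + c" 1 c] assms by simp

text \<open>
  The means \<open>v\<^sub>h = (1/h) \<integral>\<^sub>0\<^sup>h S(s) x ds\<close> converge to \<open>x\<close>, and they lie in the domain:
  \<open>S(r)\<close> only shifts the interval of integration, so the difference quotient of \<open>v\<^sub>h\<close> is built
  from means over short intervals at the two ends \<open>0\<close> and \<open>h\<close>.
\<close>

lemma generator_domain_dense:
  fixes S :: "real \<Rightarrow> 'a::banach \<Rightarrow>\<^sub>L 'a"
  assumes S: "c0_semigroup S"
  shows "closure (dom (generator S)) = UNIV"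
proof (intro equalityI subset_UNIV subsetI)
  fix x :: 'a
  define f where "f = (\<lambda>s. blinfun_apply (S s) x)"
  have cont: "continuous_on {0..b} f" for b
    unfolding f_def by (rule continuous_on_subset[OF c0_semigroup_continuous_on[OF S]]) auto
  have int: "f integrable_on {a..b}" if "a \<ge> 0" for a b
    by (rule integrable_continuous_real, rule continuous_on_subset[OF cont[of b]]) (use that in auto)
  have in_dom: "integral {0..h} f /\<^sub>R h \<in> dom (generator S)" if h: "h > 0" for h
  proof -
    define v where "v = integral {0..h} f"
    have incr: "blinfun_apply (S r) v - v = integral {h..h + r} f - integral {0..0 + r} f"
      if r: "r > 0" for r
    proof -
      have "((\<lambda>s. blinfun_apply (S r) (f s)) has_integral blinfun_apply (S r) v) {0..h}"
        using has_integral_linear[OF integrable_integral[OF int[of 0 h]] blinfun.bounded_linear_right]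
        by (simp add: v_def o_def)
      moreover have "((\<lambda>s. f (s + r)) has_integral integral {r..h + r} f) {0..h}"
        using has_integral_shift[of f "integral {r..h + r} f" 0 r h] int[of r "h + r"] r by auto
      then have "((\<lambda>s. blinfun_apply (S r) (f s)) has_integral integral {r..h + r} f) {0..h}"
        by (rule has_integral_eq[rotated]) (use r c0_semigroup_add[OF S, of r] in
          \<open>auto simp: f_def add.commute\<close>)
      ultimately have "blinfun_apply (S r) v = integral {r..h + r} f"
        by (rule has_integral_unique)
      moreover have "integral {0..r} f + integral {r..h + r} f = integral {0..h + r} f"
        using r h by (intro Henstock_Kurzweil_Integration.integral_combine int) auto
      moreover have "v + integral {h..h + r} f = integral {0..h + r} f"
        unfolding v_def using r h by (intro Henstock_Kurzweil_Integration.integral_combine int) auto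
      ultimately have "blinfun_apply (S r) v = integral {0..h + r} f - integral {0..r} f"
        "integral {h..h + r} f = integral {0..h + r} f - v"
        by (simp_all add: eq_diff_eq add.commute)
      then show ?thesis by simp
    qed
    have lim: "((\<lambda>r. integral {h..h + r} f /\<^sub>R r - integral {0..0 + r} f /\<^sub>R r) \<longlongrightarrow> f h - f 0) (at_right 0)"
      by (intro tendsto_diff tendsto_integral_mean[where b="h + 1"])
         (use h cont[of "h + 1"] in \<open>auto intro: continuous_on_subset\<close>)
    have "((\<lambda>r. (blinfun_apply (S r) (v /\<^sub>R h) - v /\<^sub>R h) /\<^sub>R r) \<longlongrightarrow> (f h - f 0) /\<^sub>R h) (at_right 0)"
    proof (rule Lim_transform_eventually[OF tendsto_scaleR[OF tendsto_const lim]])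
      show "\<forall>\<^sub>F r in at_right 0. inverse h *\<^sub>R (integral {h..h + r} f /\<^sub>R r - integral {0..0 + r} f /\<^sub>R r)
          = (blinfun_apply (S r) (v /\<^sub>R h) - v /\<^sub>R h) /\<^sub>R r"
        using eventually_at_right_less[of 0]
      proof eventually_elim
        case (elim r)
        have "(blinfun_apply (S r) (v /\<^sub>R h) - v /\<^sub>R h) /\<^sub>R r = inverse h *\<^sub>R ((blinfun_apply (S r) v - v) /\<^sub>R r)"
          by (simp add: blinfun.scaleR_right scaleR_diff_right mult.commute)
        then show ?case by (simp only: incr[OF elim] scaleR_diff_right)
      qed
    qed
    then show ?thesis unfolding v_def[symmetric] using generator_eq_Some_iff by blast
  qed
  have "((\<lambda>h. integral {0..0 + h} f /\<^sub>R h) \<longlongrightarrow> f 0) (at_right 0)"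
    by (rule tendsto_integral_mean[OF cont, of 1]) simp
  then have "((\<lambda>h. integral {0..h} f /\<^sub>R h) \<longlongrightarrow> x) (at_right 0)"
    by (simp add: f_def c0_semigroup_zero[OF S])
  then show "x \<in> closure (dom (generator S))"
  proof (rule Lim_in_closed_set[OF closed_closure _ trivial_limit_at_right_real, rotated])
    show "\<forall>\<^sub>F h in at_right 0. integral {0..h} f /\<^sub>R h \<in> closure (dom (generator S))"
      using eventually_at_right_less[of 0]
      by eventually_elim (use in_dom closure_subset in blast)
  qed
qed


section \<open>The semigroup generated by the adjoint\<close>

lemma eq_if_inner_eq_on_dense:
  fixes y :: "'a::real_inner"
  assumes "closure D = UNIV" and "\<And>x. x \<in> D \<Longrightarrow> x \<bullet> y = x \<bullet> y'"
  shows "y = y'"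
proof -
  have "closure D \<subseteq> {x. x \<bullet> y = x \<bullet> y'}"
    using assms(2) by (intro closure_minimal closed_Collect_eq continuous_intros) auto
  then show ?thesis using assms(1) by (intro vector_eq_ldot[THEN iffD1]) auto
qed

text \<open>
  On a dense domain the vector selected in the definition of \<open>adjoint_op\<close> is unique, so it has
  the defining property.
\<close>

lemma adjoint_op_inner:
  fixes A :: "'a::real_inner \<rightharpoonup> 'a"
  assumes dense: "closure (dom A) = UNIV" and z: "z \<in> dom (adjoint_op A)" and x: "x \<in> dom A"
  shows "the (A x) \<bullet> z = x \<bullet> the (adjoint_op A z)"
proof -
  define P where "P y \<longleftrightarrow> (\<forall>x\<in>dom A. the (A x) \<bullet> z = x \<bullet> y)" for y
  have "\<exists>y. P y" using z unfolding adjoint_op_def P_def by (auto split: if_splits)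
  then obtain y where y: "P y" by blast
  have "P (THE y. P y)"
  proof (rule theI[of P, OF y])
    show "y' = y" if "P y'" for y'
      using that y by (intro eq_if_inner_eq_on_dense[OF dense]) (simp add: P_def)
  qed
  moreover have "adjoint_op A z = Some (THE y. P y)"
    using y unfolding adjoint_op_def P_def by auto
  ultimately show ?thesis using x by (simp add: P_def)
qed

text \<open>
  Divide \<open>[0, t]\<close> into \<open>n\<close> steps of length \<open>h = t/n\<close> and telescope \<open>\<langle>S(jh) x, R(t - jh) y\<rangle>\<close>.
  One step equals \<open>h (\<langle>S(s) A\<^sub>h x, R(r) y\<rangle> - \<langle>S(s) x, R(r) L\<^sub>h y\<rangle>)\<close>, where \<open>A\<^sub>h\<close>, \<open>L\<^sub>h\<close> are the difference
  quotients at \<open>0\<close>.  If these are replaced by the generators the bracket vanishes, since the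
  generators commute with the semigroups and are adjoint to each other.  So the step is
  \<open>h\<close> times an error that tends to \<open>0\<close> uniformly in \<open>s\<close> and \<open>r\<close>.
\<close>

lemma adjoint_generator_semigroup_on_domain:
  fixes S R :: "real \<Rightarrow> 'h::{real_inner,banach} \<Rightarrow>\<^sub>L 'h"
  assumes S: "c0_semigroup S" and R: "c0_semigroup R"
    and gen: "generator R = adjoint_op (generator S)" and t: "t > 0"
    and x: "x \<in> dom (generator S)" and y: "y \<in> dom (generator R)"
  shows "blinfun_apply (S t) x \<bullet> y = x \<bullet> blinfun_apply (R t) y"
proof -
  define a l where "a = the (generator S x)" and "l = the (generator R y)"
  define \<alpha> \<beta> where "\<alpha> h = (blinfun_apply (S h) x - x) /\<^sub>R h"
    and "\<beta> h = (blinfun_apply (R h) y - y) /\<^sub>R h" for h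
  obtain M1 where M1: "M1 \<ge> 1" "\<And>s. s \<in> {0..t} \<Longrightarrow> norm (S s) \<le> M1"
    using c0_semigroup_bounded[OF S] by blast
  obtain M2 where M2: "M2 \<ge> 1" "\<And>s. s \<in> {0..t} \<Longrightarrow> norm (R s) \<le> M2"
    using c0_semigroup_bounded[OF R] by blast
  define e where "e h = M1 * M2 * (norm (\<alpha> h - a) * norm y + norm x * norm (\<beta> h - l))" for h
  have e_nonneg: "e h \<ge> 0" for h using M1 M2 by (simp add: e_def)
  have bound: "\<bar>blinfun_apply (S s) u \<bullet> blinfun_apply (R r) v\<bar> \<le> M1 * M2 * (norm u * norm v)"
    if "s \<in> {0..t}" "r \<in> {0..t}" for s r u v
  proof -
    have "\<bar>blinfun_apply (S s) u \<bullet> blinfun_apply (R r) v\<bar>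
        \<le> norm (blinfun_apply (S s) u) * norm (blinfun_apply (R r) v)"
      by (rule Cauchy_Schwarz_ineq2)
    also have "\<dots> \<le> (norm (S s) * norm u) * (norm (R r) * norm v)"
      by (intro mult_mono norm_blinfun) auto
    also have "\<dots> \<le> (M1 * norm u) * (M2 * norm v)"
      using M1 M2 that by (intro mult_mono mult_right_mono) auto
    finally show ?thesis by (simp add: mult_ac)
  qed
  have step: "\<bar>blinfun_apply (S (s + h)) x \<bullet> blinfun_apply (R r) y
      - blinfun_apply (S s) x \<bullet> blinfun_apply (R (r + h)) y\<bar> \<le> h * e h"
    if sr: "0 \<le> s" "0 < h" "0 \<le> r" "s + h + r \<le> t" for s h r
  proof -
    have xs: "blinfun_apply (S (s + h)) x = blinfun_apply (S s) x + h *\<^sub>R blinfun_apply (S s) (\<alpha> h)"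
      using sr by (simp add: c0_semigroup_add[OF S] \<alpha>_def blinfun.scaleR_right blinfun.diff_right)
    have ys: "blinfun_apply (R (r + h)) y = blinfun_apply (R r) y + h *\<^sub>R blinfun_apply (R r) (\<beta> h)"
      using sr by (simp add: c0_semigroup_add[OF R] \<beta>_def blinfun.scaleR_right blinfun.diff_right)
    have "the (generator S (blinfun_apply (S s) x)) \<bullet> blinfun_apply (R r) y
        = blinfun_apply (S s) x \<bullet> the (generator R (blinfun_apply (R r) y))"
      unfolding gen
    proof (rule adjoint_op_inner[OF generator_domain_dense[OF S]])
      show "blinfun_apply (R r) y \<in> dom (adjoint_op (generator S))"
        using generator_commutes[OF R sr(3) y] unfolding gen by blast
      show "blinfun_apply (S s) x \<in> dom (generator S)"
        using generator_commutes[OF S sr(1) x] by blast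
    qed
    then have al: "blinfun_apply (S s) a \<bullet> blinfun_apply (R r) y
        = blinfun_apply (S s) x \<bullet> blinfun_apply (R r) l"
      by (simp add: generator_commutes[OF R sr(3) y] generator_commutes[OF S sr(1) x] a_def l_def)
    have "blinfun_apply (S (s + h)) x \<bullet> blinfun_apply (R r) y
          - blinfun_apply (S s) x \<bullet> blinfun_apply (R (r + h)) y
        = h * (blinfun_apply (S s) (\<alpha> h - a) \<bullet> blinfun_apply (R r) y
             - blinfun_apply (S s) x \<bullet> blinfun_apply (R r) (\<beta> h - l))"
      using al unfolding xs ys by (simp add: inner_add_left inner_add_right inner_diff_left inner_diff_right
        blinfun.diff_right algebra_simps)
    then have "\<bar>blinfun_apply (S (s + h)) x \<bullet> blinfun_apply (R r) y
          - blinfun_apply (S s) x \<bullet> blinfun_apply (R (r + h)) y\<bar>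
        = h * \<bar>blinfun_apply (S s) (\<alpha> h - a) \<bullet> blinfun_apply (R r) y
             - blinfun_apply (S s) x \<bullet> blinfun_apply (R r) (\<beta> h - l)\<bar>"
      using sr by (simp add: abs_mult)
    also have "\<dots> \<le> h * (M1 * M2 * (norm (\<alpha> h - a) * norm y) + M1 * M2 * (norm x * norm (\<beta> h - l)))"
      using sr by (intro mult_left_mono order_trans[OF abs_triangle_ineq4] add_mono bound) auto
    finally show ?thesis by (simp add: e_def distrib_left)
  qed
  have telescope: "\<bar>blinfun_apply (S t) x \<bullet> y - x \<bullet> blinfun_apply (R t) y\<bar> \<le> t * e (t / real (Suc n))" for n
  proof -
    define h where "h = t / real (Suc n)"
    have h: "h > 0" "real (Suc n) * h = t" using t by (auto simp: h_def)
    have "\<bar>blinfun_apply (S (real j * h)) x \<bullet> blinfun_apply (R (t - real j * h)) y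
        - x \<bullet> blinfun_apply (R t) y\<bar> \<le> real j * (h * e h)" if "j \<le> Suc n" for j
      using that
    proof (induction j)
      case 0
      then show ?case by (simp add: c0_semigroup_zero[OF S])
    next
      case (Suc j)
      have "real (Suc j) * h \<le> t" using Suc.prems h by (metis mult_right_mono less_imp_le of_nat_mono)
      then have "\<bar>blinfun_apply (S (real j * h + h)) x \<bullet> blinfun_apply (R (t - real (Suc j) * h)) y
        - blinfun_apply (S (real j * h)) x \<bullet> blinfun_apply (R (t - real (Suc j) * h + h)) y\<bar> \<le> h * e h"
        using h by (intro step) (auto simp: algebra_simps)
      then show ?case using Suc.IH Suc.prems by (simp add: algebra_simps)
    qed
    from this[of "Suc n"] have "\<bar>blinfun_apply (S t) x \<bullet> y - x \<bullet> blinfun_apply (R t) y\<bar> \<le> (real (Suc n) * h) * e h"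
      unfolding h(2) by (simp add: c0_semigroup_zero[OF R] h(2) mult.assoc[symmetric] del: of_nat_Suc)
    then show ?thesis by (simp only: h(2)) (simp add: h_def)
  qed
  have "(\<lambda>n. t * inverse (real (Suc n))) \<longlonglongrightarrow> t * 0"
    by (intro tendsto_intros LIMSEQ_inverse_real_of_nat)
  then have lim: "filterlim (\<lambda>n. t / real (Suc n)) (at_right 0) sequentially"
    using t by (auto simp: filterlim_at divide_inverse)
  have "(e \<longlongrightarrow> M1 * M2 * (norm (a - a) * norm y + norm x * norm (l - l))) (at_right 0)"
    unfolding e_def \<alpha>_def \<beta>_def a_def l_def
    by (intro tendsto_intros generator_domain_tendsto x y)
  then have "(\<lambda>n. t * e (t / real (Suc n))) \<longlonglongrightarrow> t * 0"
    by (intro tendsto_mult tendsto_const filterlim_compose[OF _ lim]) simp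
  then have "\<bar>blinfun_apply (S t) x \<bullet> y - x \<bullet> blinfun_apply (R t) y\<bar> \<le> t * 0"
    using telescope by (intro LIMSEQ_le_const) auto
  then show ?thesis by simp
qed

lemma adjoint_generator_semigroup:
  fixes S R :: "real \<Rightarrow> 'h::{real_inner,banach} \<Rightarrow>\<^sub>L 'h"
  assumes S: "c0_semigroup S" and R: "c0_semigroup R"
    and gen: "generator R = adjoint_op (generator S)" and t: "t > 0"
  shows "blinfun_apply (S t) x \<bullet> y = x \<bullet> blinfun_apply (R t) y"
proof -
  have "closure (dom (generator S)) \<subseteq> {x. blinfun_apply (S t) x \<bullet> y = x \<bullet> blinfun_apply (R t) y}"
    if "y \<in> dom (generator R)" for y
    using adjoint_generator_semigroup_on_domain[OF S R gen t _ that]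
    by (intro closure_minimal closed_Collect_eq continuous_intros) auto
  then have "closure (dom (generator R)) \<subseteq> {y. blinfun_apply (S t) x \<bullet> y = x \<bullet> blinfun_apply (R t) y}"
    by (intro closure_minimal closed_Collect_eq continuous_intros)
       (use generator_domain_dense[OF S] in auto)
  then show ?thesis using generator_domain_dense[OF R] by auto
qed

section \<open>Analyticity in time\<close>

text \<open>
  In polar coordinates a sector is a rectangle, hence connected.
\<close>

lemma sector_eq_rcis_image:
  assumes "0 < \<theta>" "\<theta> \<le> pi / 2"
  shows "sector \<theta> = (\<lambda>(r, a). rcis r a) ` ({0<..} \<times> {-\<theta><..<\<theta>})"
proof (intro equalityI subsetI)
  fix z assume "z \<in> sector \<theta>"
  then show "z \<in> (\<lambda>(r, a). rcis r a) ` ({0<..} \<times> {-\<theta><..<\<theta>})"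
    by (intro image_eqI[of _ _ "(cmod z, Arg z)"]) (auto simp: sector_def rcis_cmod_Arg)
next
  fix z assume "z \<in> (\<lambda>(r, a). rcis r a) ` ({0<..} \<times> {-\<theta><..<\<theta>})"
  then obtain r a where z: "z = rcis r a" "r > 0" "- \<theta> < a" "a < \<theta>" by auto
  then have "Arg z = a" using assms pi_gt_zero by (auto intro!: Arg_rcis)
  moreover have "z \<noteq> 0" using z by (simp add: rcis_def)
  ultimately show "z \<in> sector \<theta>" using z by (simp add: sector_def abs_less_iff)
qed

lemma connected_sector:
  assumes "0 < \<theta>" "\<theta> \<le> pi / 2"
  shows "connected (sector \<theta>)"
  unfolding sector_eq_rcis_image[OF assms] rcis_def case_prod_unfold
  by (intro connected_continuous_image continuous_intros convex_connected convex_Times) auto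

lemma open_sector:
  assumes "0 < \<theta>" "\<theta> \<le> pi / 2"
  shows "open (sector \<theta>)"
proof -
  have "sector \<theta> = {z. 0 < Re z} \<inter> Arg -` {-\<theta><..<\<theta>}"
  proof -
    have "Re z > 0" if "z \<noteq> 0" "\<bar>Arg z\<bar> < \<theta>" for z using Arg_Re_pos[of z] that assms by auto
    then show ?thesis by (auto simp: sector_def abs_less_iff minus_less_iff)
  qed
  moreover have "continuous_on {z. 0 < Re z} Arg"
    by (rule continuous_on_subset[OF continuous_on_Arg]) (auto simp: complex_nonpos_Reals_iff)
  ultimately show ?thesis
    by (auto intro!: continuous_open_preimage open_halfspace_Re_gt)
qed

text \<open>
  The analytic extension \<open>E\<close> makes \<open>t \<mapsto> \<langle>S(t) x, y\<rangle>\<close> the restriction of a holomorphic function on a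
  sector, to which the identity theorem applies.
\<close>

lemma analytic_semigroup_inner_vanishes:
  fixes S :: "real \<Rightarrow> 'h::{real_inner,banach} \<Rightarrow>\<^sub>L 'h"
  assumes "analytic_semigroup S" and \<tau>: "\<tau> > 0"
    and zero: "\<And>t. 0 < t \<Longrightarrow> t < \<tau> \<Longrightarrow> blinfun_apply (S t) x \<bullet> y = 0"
    and t: "t > 0"
  shows "blinfun_apply (S t) x \<bullet> y = 0"
proof -
  obtain \<theta> and E :: "complex \<Rightarrow> ('h \<times> 'h) \<Rightarrow>\<^sub>L ('h \<times> 'h)" where \<theta>: "0 < \<theta>" "\<theta> \<le> pi / 2"
    and E: "\<And>t x y. t > 0 \<Longrightarrow> blinfun_apply (E (complex_of_real t)) (x, y) =
                       (blinfun_apply (S t) x, blinfun_apply (S t) y)"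
    and diff: "\<And>z. z \<in> sector \<theta> \<Longrightarrow> \<exists>D. (E has_derivative D) (at z) \<and>
            (\<forall>c v. blinfun_apply (D c) v = cscale c (blinfun_apply (D 1) v))"
    using assms(1) unfolding analytic_semigroup_def by metis
  define \<Lambda> :: "'h \<times> 'h \<Rightarrow> complex"
    where "\<Lambda> v = complex_of_real (fst v \<bullet> y) + \<i> * complex_of_real (snd v \<bullet> y)" for v
  have \<Lambda>_diff: "((\<lambda>z. \<Lambda> (G z)) has_derivative (\<lambda>c. \<Lambda> (G' c))) (at z)"
    if "(G has_derivative G') (at z)" for G G' and z :: complex
    unfolding \<Lambda>_def using that by (auto intro!: derivative_eq_intros)
  have \<Lambda>_cscale: "\<Lambda> (cscale c v) = \<Lambda> v * c" for c v
    by (rule complex_eqI) (simp_all add: \<Lambda>_def cscale_def inner_add_left inner_diff_left algebra_simps)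
  define F where "F z = \<Lambda> (blinfun_apply (E z) (x, 0))" for z
  have holo: "F holomorphic_on sector \<theta>"
    unfolding holomorphic_on_open[OF open_sector[OF \<theta>]]
  proof
    fix z assume "z \<in> sector \<theta>"
    then obtain D where D: "(E has_derivative D) (at z)"
      "\<And>c v. blinfun_apply (D c) v = cscale c (blinfun_apply (D 1) v)" using diff by blast
    have "((\<lambda>z. blinfun_apply (E z) (x, 0)) has_derivative (\<lambda>c. blinfun_apply (D c) (x, 0))) (at z)"
      by (rule bounded_linear.has_derivative[OF blinfun.bounded_linear_left D(1)])
    then have "(F has_derivative (\<lambda>c. \<Lambda> (blinfun_apply (D c) (x, 0)))) (at z)"
      unfolding F_def by (rule \<Lambda>_diff)
    moreover have "(\<lambda>c. \<Lambda> (blinfun_apply (D c) (x, 0))) = (*) (\<Lambda> (blinfun_apply (D 1) (x, 0)))"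
    proof
      show "\<Lambda> (blinfun_apply (D c) (x, 0)) = \<Lambda> (blinfun_apply (D 1) (x, 0)) * c" for c
        using \<Lambda>_cscale[of c "blinfun_apply (D 1) (x, 0)"] unfolding D(2)[of c, symmetric] .
    qed
    ultimately have "(F has_field_derivative \<Lambda> (blinfun_apply (D 1) (x, 0))) (at z)"
      unfolding has_field_derivative_def by (rule has_derivative_eq_rhs)
    then show "\<exists>f'. (F has_field_derivative f') (at z)" by blast
  qed
  have F_real: "F (complex_of_real s) = complex_of_real (blinfun_apply (S s) x \<bullet> y)" if "s > 0" for s
    using E[OF that, of x 0] by (simp add: F_def \<Lambda>_def)
  have real_sector: "complex_of_real s \<in> sector \<theta>" if "s > 0" for s
    using that \<theta> by (simp add: sector_def)
  have limpt: "complex_of_real (\<tau> / 2) islimpt complex_of_real ` {0<..<\<tau>}"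
    unfolding islimpt_approachable
  proof (intro allI impI)
    fix e :: real assume "e > 0"
    define s where "s = \<tau> / 2 + min (e / 2) (\<tau> / 4)"
    have "s \<in> {0<..<\<tau>}" "s \<noteq> \<tau> / 2" "\<bar>s - \<tau> / 2\<bar> < e"
      using \<open>e > 0\<close> \<tau> by (auto simp: s_def min_def)
    then show "\<exists>w\<in>complex_of_real ` {0<..<\<tau>}. w \<noteq> complex_of_real (\<tau> / 2)
        \<and> dist w (complex_of_real (\<tau> / 2)) < e"
      by (intro bexI[of _ "complex_of_real s"] imageI conjI)
         (simp_all add: dist_of_real dist_real_def del: of_real_divide)
  qed
  have "F (complex_of_real t) = 0"
  proof (rule analytic_continuation[OF holo open_sector[OF \<theta>] connected_sector[OF \<theta>] _ _ limpt])
    show "complex_of_real ` {0<..<\<tau>} \<subseteq> sector \<theta>" using real_sector by auto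
    show "complex_of_real (\<tau> / 2) \<in> sector \<theta>" using \<tau> by (intro real_sector) simp
    show "F w = 0" if "w \<in> complex_of_real ` {0<..<\<tau>}" for w
      using that F_real zero by auto
  qed (rule real_sector[OF t])
  then show ?thesis using F_real[OF t] by simp
qed

text \<open>
  An observation that vanishes on a short interval vanishes for all positive times by
  analyticity, in particular on \<open>(0, T)\<close>, where the assumed property \<open>ucp\<close> applies to
  \<open>t \<mapsto> R(T - t) y\<close>.
\<close>

lemma unique_continuation_short_time:
  fixes S R :: "real \<Rightarrow> 'h::{real_inner,banach} \<Rightarrow>\<^sub>L 'h"
    and B :: "'u::{real_inner,banach} \<Rightarrow>\<^sub>L 'h"
  assumes S: "analytic_semigroup S" and R: "c0_semigroup R"
    and gen: "generator R = adjoint_op (generator S)"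
    and ucp: "\<And>zT z. \<lbrakk>backward_mild_solution (generator R) T zT (\<lambda>_. 0) z;
            \<forall>t\<in>{0<..<T}. adjoint (blinfun_apply B) (z t) = 0\<rbrakk> \<Longrightarrow> zT = 0"
    and \<tau>: "\<tau> > 0"
    and zero: "\<And>t. 0 < t \<Longrightarrow> t < \<tau> \<Longrightarrow> adjoint (blinfun_apply B) (blinfun_apply (R t) y) = 0"
  shows "y = 0"
proof (rule ucp)
  have S0: "c0_semigroup S" using S by (simp add: analytic_semigroup_def)
  have dual: "u \<bullet> adjoint (blinfun_apply B) (blinfun_apply (R t) y) = blinfun_apply (S t) (blinfun_apply B u) \<bullet> y"
    if "t > 0" for t u
    by (simp add: inner_adjoint_blinfun adjoint_generator_semigroup[OF S0 R gen that])
  have all: "adjoint (blinfun_apply B) (blinfun_apply (R t) y) = 0" if t: "t > 0" for t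
  proof -
    have "blinfun_apply (S t) (blinfun_apply B u) \<bullet> y = 0" for u
      by (rule analytic_semigroup_inner_vanishes[OF S \<tau> _ t]) (simp add: dual[symmetric] zero)
    then show ?thesis by (metis dual[OF t] inner_eq_zero_iff)
  qed
  show "\<forall>t\<in>{0<..<T}. adjoint (blinfun_apply B) (blinfun_apply (R (T - t)) y) = 0"
    using all by simp
  show "backward_mild_solution (generator R) T y (\<lambda>_. 0) (\<lambda>t. blinfun_apply (R (T - t)) y)"
    unfolding backward_mild_solution_def
    by (intro exI[of _ R] conjI R refl continuous_on_compose2[OF c0_semigroup_continuous_on[OF R]]
        continuous_intros ballI) auto
qed


section \<open>Mild solutions and finite differences\<close>

text \<open>
  Mild solutions of \<open>z' + L z = w\<close> on \<open>[0, T]\<close>, with the variation of constants formula between any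
  two times.  Unlike the formula with the fixed terminal time \<open>T\<close>, this condition restricts
  directly to shorter intervals, so that \<open>z\<close> can be combined with its translates.
\<close>

definition mild_on :: "(real \<Rightarrow> 'a::banach \<Rightarrow>\<^sub>L 'a) \<Rightarrow> (real \<Rightarrow> 'a) \<Rightarrow> (real \<Rightarrow> 'a) \<Rightarrow> real \<Rightarrow> bool" where
  "mild_on R w z T \<longleftrightarrow> (\<forall>a b. 0 \<le> a \<longrightarrow> a \<le> b \<longrightarrow> b \<le> T \<longrightarrow>
     ((\<lambda>s. blinfun_apply (R (s - a)) (w s)) has_integral (blinfun_apply (R (b - a)) (z b) - z a)) {a..b})"

lemma mild_onD:
  "\<lbrakk>mild_on R w z T; 0 \<le> a; a \<le> b; b \<le> T\<rbrakk> \<Longrightarrow>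
    ((\<lambda>s. blinfun_apply (R (s - a)) (w s)) has_integral (blinfun_apply (R (b - a)) (z b) - z a)) {a..b}"
  by (simp add: mild_on_def)

text \<open>
  Split the integral over \<open>[a, T]\<close> at \<open>b\<close>.  The semigroup property extracts \<open>R(b - a)\<close> from the
  part over \<open>[b, T]\<close>, which the formula at time \<open>b\<close> then evaluates.
\<close>

lemma mild_on_if_terminal_formula:
  assumes R: "c0_semigroup R"
    and z: "\<And>t. t \<in> {0..T} \<Longrightarrow> ((\<lambda>s. blinfun_apply (R (s - t)) (w s))
            has_integral (blinfun_apply (R (T - t)) zT - z t)) {t..T}"
  shows "mild_on R w z T"
  unfolding mild_on_def
proof (intro allI impI)
  fix a b assume ab: "0 \<le> a" "a \<le> b" "b \<le> T"
  let ?f = "\<lambda>s. blinfun_apply (R (s - a)) (w s)"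
  have whole: "(?f has_integral (blinfun_apply (R (T - a)) zT - z a)) {a..T}"
    using z ab by auto
  then have "?f integrable_on {a..b}"
    by (rule integrable_subinterval_real[OF has_integral_integrable]) (use ab in auto)
  then obtain i where i: "(?f has_integral i) {a..b}" by blast
  have "((\<lambda>s. blinfun_apply (R (b - a)) (blinfun_apply (R (s - b)) (w s))) has_integral
      blinfun_apply (R (b - a)) (blinfun_apply (R (T - b)) zT - z b)) {b..T}"
    using has_integral_linear[OF z[of b] blinfun.bounded_linear_right] ab by (simp add: o_def)
  then have "(?f has_integral blinfun_apply (R (b - a)) (blinfun_apply (R (T - b)) zT - z b)) {b..T}"
  proof (rule has_integral_eq[rotated])
    fix s assume s: "s \<in> {b..T}"
    then have "blinfun_apply (R ((b - a) + (s - b))) (w s) = blinfun_apply (R (b - a)) (blinfun_apply (R (s - b)) (w s))"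
      using ab by (intro c0_semigroup_add[OF R]) auto
    then show "blinfun_apply (R (b - a)) (blinfun_apply (R (s - b)) (w s)) = ?f s" by simp
  qed
  from has_integral_combine[OF ab(2,3) i this]
  have "i + blinfun_apply (R (b - a)) (blinfun_apply (R (T - b)) zT - z b)
      = blinfun_apply (R (T - a)) zT - z a"
    by (rule has_integral_unique) (rule whole)
  moreover have "blinfun_apply (R ((b - a) + (T - b))) zT = blinfun_apply (R (b - a)) (blinfun_apply (R (T - b)) zT)"
    using ab by (intro c0_semigroup_add[OF R]) auto
  ultimately have "i = blinfun_apply (R (b - a)) (z b) - z a"
    by (simp add: blinfun.diff_right algebra_simps)
  with i show "(?f has_integral (blinfun_apply (R (b - a)) (z b) - z a)) {a..b}" by simp
qed

lemma mild_on_cong: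
  assumes "mild_on R w z T" and "\<And>t. t \<in> {0<..<T} \<Longrightarrow> w t = w' t"
  shows "mild_on R w' z T"
  unfolding mild_on_def
proof (intro allI impI)
  fix a b assume ab: "0 \<le> a" "a \<le> b" "b \<le> T"
  show "((\<lambda>s. blinfun_apply (R (s - a)) (w' s)) has_integral (blinfun_apply (R (b - a)) (z b) - z a)) {a..b}"
    by (rule has_integral_spike_finite[of "{0, T}", OF _ _ mild_onD[OF assms(1) ab]])
       (use ab assms(2) in \<open>auto simp: less_le\<close>)
qed

text \<open>
  A finite difference in the role of \<open>d/dt - m\<close>: it annihilates \<open>e\<^sup>m\<^sup>t\<close>.
\<close>

definition exp_difference :: "real \<Rightarrow> real \<Rightarrow> (real \<Rightarrow> 'a::real_vector) \<Rightarrow> real \<Rightarrow> 'a" where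
  "exp_difference m \<delta> f = (\<lambda>t. f t - exp (- m * \<delta>) *\<^sub>R f (t + \<delta>))"

lemma mild_on_exp_difference:
  assumes z: "mild_on R w z T" and \<delta>: "0 \<le> \<delta>"
  shows "mild_on R (exp_difference m \<delta> w) (exp_difference m \<delta> z) (T - \<delta>)"
  unfolding mild_on_def
proof (intro allI impI)
  fix a b assume ab: "0 \<le> a" "a \<le> b" "b \<le> T - \<delta>"
  have "((\<lambda>s. blinfun_apply (R (s - a)) (w (s + \<delta>))) has_integral
      (blinfun_apply (R (b - a)) (z (b + \<delta>)) - z (a + \<delta>))) {a..b}"
    using has_integral_shift[OF mild_onD[OF z, of "a + \<delta>" "b + \<delta>"]] ab \<delta> by simp
  from has_integral_diff[OF mild_onD[OF z, of a b] has_integral_cmul[OF this, of "exp (- m * \<delta>)"]]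
  show "((\<lambda>s. blinfun_apply (R (s - a)) (exp_difference m \<delta> w s)) has_integral
      (blinfun_apply (R (b - a)) (exp_difference m \<delta> z b) - exp_difference m \<delta> z a)) {a..b}"
    using ab \<delta> by (simp add: exp_difference_def blinfun.diff_right blinfun.scaleR_right algebra_simps)
qed

lemma exp_difference_exp_sum:
  "exp_difference m \<delta> (\<lambda>t. \<Sum>i\<in>I. exp (\<nu> i * t) *\<^sub>R p i)
    = (\<lambda>t. \<Sum>i\<in>I. exp (\<nu> i * t) *\<^sub>R ((1 - exp ((\<nu> i - m) * \<delta>)) *\<^sub>R p i))"
  by (auto simp: exp_difference_def scaleR_sum_right sum_subtractf[symmetric] exp_add[symmetric]
      algebra_simps intro!: sum.cong)

section \<open>Exponential data\<close>

text \<open>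
  The difference of \<open>z\<close> with parameter \<open>\<delta>\<close> solves the homogeneous equation and is not observed
  by \<open>C\<close>, so it vanishes.  This holds for all \<open>\<delta> \<in> (0, T)\<close>, hence \<open>z(t) = e\<^sup>m\<^sup>t z(0)\<close>.  Dividing the
  formula for the mild solution on \<open>[0, h]\<close> by \<open>h\<close> and letting \<open>h \<rightarrow> 0\<close> shows that \<open>a = z(0)\<close> is in
  the domain of the generator \<open>L\<close> and \<open>L a = p - m a\<close>.
\<close>

lemma single_exponential_vanishes:
  fixes R :: "real \<Rightarrow> 'h::banach \<Rightarrow>\<^sub>L 'h" and C :: "'h \<Rightarrow> 'u::real_vector"
  assumes R: "c0_semigroup R" and C: "linear C"
    and ucp: "\<And>\<tau> y. \<lbrakk>\<tau> > 0; \<And>t. 0 < t \<Longrightarrow> t < \<tau> \<Longrightarrow> C (blinfun_apply (R t) y) = 0\<rbrakk> \<Longrightarrow> y = 0"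
    and T: "T > 0"
    and z: "mild_on R (\<lambda>t. exp (m * t) *\<^sub>R p) z T"
    and Cz: "\<And>t. t \<in> {0<..<T} \<Longrightarrow> C (z t) = exp (m * t) *\<^sub>R q"
    and stationary: "\<And>a. \<lbrakk>generator R a = Some (p - m *\<^sub>R a); C a = q\<rbrakk> \<Longrightarrow> a = 0"
  shows "p = 0 \<and> q = 0"
proof -
  interpret C: linear C by fact
  have z_exp: "z \<delta> = exp (m * \<delta>) *\<^sub>R z 0" if \<delta>: "0 \<le> \<delta>" "\<delta> < T" for \<delta>
  proof (cases "\<delta> = 0")
    case False
    define d where "d = exp_difference m \<delta> z"
    have "exp_difference m \<delta> (\<lambda>t. exp (m * t) *\<^sub>R p) = (\<lambda>_. 0)"
      using exp_difference_exp_sum[of m \<delta> "\<lambda>_. m" "\<lambda>_. p" "{()}"] by simp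
    with mild_on_exp_difference[OF z \<delta>(1), of m] have "mild_on R (\<lambda>_. 0) d (T - \<delta>)"
      by (simp add: d_def)
    from mild_onD[OF this] have d: "d a = blinfun_apply (R (b - a)) (d b)"
      if "0 \<le> a" "a \<le> b" "b \<le> T - \<delta>" for a b
      using that by (fastforce dest: has_integral_unique[OF has_integral_0])
    have "d (T - \<delta>) = 0"
    proof (rule ucp)
      show "T - \<delta> > 0" using \<delta> by simp
      fix t assume t: "0 < t" "t < T - \<delta>"
      have "C (d (T - \<delta> - t)) = 0"
        using t \<delta> by (simp add: d_def exp_difference_def C.diff C.scale Cz exp_add[symmetric] algebra_simps)
      then show "C (blinfun_apply (R t) (d (T - \<delta>))) = 0"
        using d[of "T - \<delta> - t" "T - \<delta>"] t by simp
    qed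
    then have "d 0 = 0" using d[of 0 "T - \<delta>"] \<delta> by simp
    then have "exp (m * \<delta>) *\<^sub>R z 0 = (exp (m * \<delta>) * exp (- m * \<delta>)) *\<^sub>R z \<delta>"
      by (simp add: d_def exp_difference_def)
    then show ?thesis by (simp add: exp_add[symmetric])
  qed simp
  define a where "a = z 0"
  have "generator R a = Some (p - m *\<^sub>R a)"
    unfolding generator_eq_Some_iff
  proof (rule Lim_transform_eventually)
    define f where "f = (\<lambda>s. blinfun_apply (R s) (exp (m * s) *\<^sub>R p))"
    have "continuous_on {0..T} f"
      unfolding f_def blinfun.scaleR_right
      by (intro continuous_intros continuous_on_subset[OF c0_semigroup_continuous_on[OF R]]) auto
    then have "((\<lambda>h. integral {0..0 + h} f /\<^sub>R h) \<longlongrightarrow> f 0) (at_right 0)"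
      by (rule tendsto_integral_mean) (rule T)
    then have mean: "((\<lambda>h. integral {0..h} f /\<^sub>R h) \<longlongrightarrow> p) (at_right 0)"
      by (simp add: f_def c0_semigroup_zero[OF R])
    have "((\<lambda>h. exp (- m * h)) has_real_derivative - m) (at 0)"
      by (auto intro!: derivative_eq_intros)
    then have "((\<lambda>h. (exp (- m * h) - 1) / h) \<longlongrightarrow> - m) (at 0)"
      by (simp add: DERIV_def)
    then have slope: "((\<lambda>h. (exp (- m * h) - 1) / h) \<longlongrightarrow> - m) (at_right 0)"
      by (rule filterlim_mono[OF _ order_refl]) (simp add: at_le)
    \<comment> \<open>\<open>R(h) a - a\<close> differs from \<open>e\<^sup>-\<^sup>m\<^sup>h\<close> times the integral by the increment of \<open>e\<^sup>-\<^sup>m\<^sup>h a\<close>\<close>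
    have "((\<lambda>h. exp (- m * h)) \<longlongrightarrow> exp (- m * 0)) (at_right 0)" by (intro tendsto_intros)
    then show "((\<lambda>h. exp (- m * h) *\<^sub>R (integral {0..h} f /\<^sub>R h) + ((exp (- m * h) - 1) / h) *\<^sub>R a)
        \<longlongrightarrow> p - m *\<^sub>R a) (at_right 0)"
      using tendsto_add[OF tendsto_scaleR[OF _ mean] tendsto_scaleR[OF slope tendsto_const[of a]]]
      by fastforce
    have "exp (- m * h) *\<^sub>R (integral {0..h} f /\<^sub>R h) + ((exp (- m * h) - 1) / h) *\<^sub>R a
        = (blinfun_apply (R h) a - a) /\<^sub>R h" if h: "0 < h" "h < T" for h
    proof -
      have "(f has_integral (blinfun_apply (R h) (z h) - z 0)) {0..h}"
        using mild_onD[OF z, of 0 h] h by (simp add: f_def)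
      then have "integral {0..h} f = exp (m * h) *\<^sub>R blinfun_apply (R h) a - a"
        using z_exp[of h] h by (simp add: integral_unique a_def blinfun.scaleR_right)
      then have "exp (- m * h) *\<^sub>R integral {0..h} f + (exp (- m * h) - 1) *\<^sub>R a = blinfun_apply (R h) a - a"
        by (simp add: scaleR_diff_right scaleR_diff_left exp_add[symmetric])
      then show ?thesis
        by (metis (no_types, lifting) divide_inverse mult.commute scaleR_add_right scaleR_left_commute scaleR_scaleR)
    qed
    then show "\<forall>\<^sub>F h in at_right 0. exp (- m * h) *\<^sub>R (integral {0..h} f /\<^sub>R h) + ((exp (- m * h) - 1) / h) *\<^sub>R a
        = (blinfun_apply (R h) a - a) /\<^sub>R h"
      unfolding eventually_at_right_field using T by auto
  qed
  moreover have Ca: "C a = q"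
  proof -
    have "exp (m * (T / 2)) *\<^sub>R C a = exp (m * (T / 2)) *\<^sub>R q"
      using Cz[of "T / 2"] z_exp[of "T / 2"] T by (simp add: a_def C.scale)
    then show ?thesis by simp
  qed
  ultimately have "a = 0" by (rule stationary)
  moreover have "generator R 0 = Some 0" by (simp add: generator_eq_Some_iff)
  ultimately show ?thesis using \<open>generator R a = _\<close> Ca by (simp add: C.zero)
qed

text \<open>
  Induction on the set of exponents.  The difference for one exponent \<open>\<nu>\<^sub>j\<close> leaves a solution with
  the other exponents, whose coefficients are multiplied by \<open>1 - exp ((\<nu>\<^sub>i - \<nu>\<^sub>j) \<delta>)\<close>; these factors
  are not zero and keep the coefficients in the subspaces \<open>V\<^sub>i\<close>, \<open>X\<^sub>i\<close>.  By induction the other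
  coefficients vanish, so \<open>z\<close> itself has the single exponent \<open>\<nu>\<^sub>j\<close>.
\<close>

lemma exponential_sum_vanishes:
  fixes R :: "real \<Rightarrow> 'h::banach \<Rightarrow>\<^sub>L 'h" and C :: "'h \<Rightarrow> 'u::real_vector"
  assumes R: "c0_semigroup R" and C: "linear C"
    and ucp: "\<And>\<tau> y. \<lbrakk>\<tau> > 0; \<And>t. 0 < t \<Longrightarrow> t < \<tau> \<Longrightarrow> C (blinfun_apply (R t) y) = 0\<rbrakk> \<Longrightarrow> y = 0"
    and "finite I" and "inj_on \<nu> I" and "T > 0"
    and "\<And>i. i \<in> I \<Longrightarrow> subspace (V i)" and "\<And>i. i \<in> I \<Longrightarrow> subspace (X i)"
    and "\<And>i. i \<in> I \<Longrightarrow> p i \<in> V i" and "\<And>i. i \<in> I \<Longrightarrow> q i \<in> X i"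
    and "\<And>i a b. \<lbrakk>i \<in> I; generator R a = Some b; \<nu> i *\<^sub>R a + b \<in> V i; C a \<in> X i\<rbrakk> \<Longrightarrow> a = 0"
    and "mild_on R (\<lambda>t. \<Sum>i\<in>I. exp (\<nu> i * t) *\<^sub>R p i) z T"
    and "\<And>t. t \<in> {0<..<T} \<Longrightarrow> C (z t) = (\<Sum>i\<in>I. exp (\<nu> i * t) *\<^sub>R q i)"
  shows "\<forall>i\<in>I. p i = 0 \<and> q i = 0"
  using assms(4-)
proof (induction I arbitrary: T p q z)
  case empty
  then show ?case by simp
next
  case (insert j I)
  interpret C: linear C by fact
  define \<delta> where "\<delta> = T / 2"
  have \<delta>: "\<delta> > 0" "\<delta> < T" using insert.prems by (auto simp: \<delta>_def)
  define c where "c i = 1 - exp ((\<nu> i - \<nu> j) * \<delta>)" for i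
  have cj: "c j = 0" by (simp add: c_def)
  have c: "c i \<noteq> 0" if "i \<in> I" for i
  proof -
    have "\<nu> i \<noteq> \<nu> j" using inj_onD[OF insert.prems(1), of i j] that insert.hyps by blast
    then show ?thesis using \<delta> by (simp add: c_def)
  qed
  have "\<forall>i\<in>I. c i *\<^sub>R p i = 0 \<and> c i *\<^sub>R q i = 0"
  proof (rule insert.IH)
    show "inj_on \<nu> I" "T - \<delta> > 0" using insert.prems(1) \<delta> by (auto simp: inj_on_def)
    show "mild_on R (\<lambda>t. \<Sum>i\<in>I. exp (\<nu> i * t) *\<^sub>R (c i *\<^sub>R p i)) (exp_difference (\<nu> j) \<delta> z) (T - \<delta>)"
      using mild_on_exp_difference[OF insert.prems(8), of \<delta> "\<nu> j"] \<delta> insert.hyps cj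
      unfolding exp_difference_exp_sum by (simp add: c_def)
    show "C (exp_difference (\<nu> j) \<delta> z t) = (\<Sum>i\<in>I. exp (\<nu> i * t) *\<^sub>R (c i *\<^sub>R q i))"
      if t: "t \<in> {0<..<T - \<delta>}" for t
    proof -
      have "C (exp_difference (\<nu> j) \<delta> z t) = exp_difference (\<nu> j) \<delta> (\<lambda>t. \<Sum>i\<in>insert j I. exp (\<nu> i * t) *\<^sub>R q i) t"
        using t \<delta> insert.prems(9)[of t] insert.prems(9)[of "t + \<delta>"]
        by (simp add: exp_difference_def C.diff C.scale)
      also have "\<dots> = (\<Sum>i\<in>I. exp (\<nu> i * t) *\<^sub>R (c i *\<^sub>R q i))"
        unfolding exp_difference_exp_sum using insert.hyps cj by (simp add: c_def)
      finally show ?thesis .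
    qed
    show "a = 0" if "i \<in> I" "generator R a = Some b" "\<nu> i *\<^sub>R a + b \<in> V i" "C a \<in> X i" for i a b
      using insert.prems(7)[of i a b] that by blast
  qed (use insert.prems(3-6) in \<open>auto intro: subspace_scale\<close>)
  then have zero: "\<forall>i\<in>I. p i = 0 \<and> q i = 0" using c by auto
  have "p j = 0 \<and> q j = 0"
  proof (rule single_exponential_vanishes[where T = T and z = z and m = "\<nu> j", OF R C])
    show "y = 0" if "\<tau> > 0" "\<And>t. 0 < t \<Longrightarrow> t < \<tau> \<Longrightarrow> C (blinfun_apply (R t) y) = 0" for \<tau> y
      using that by (rule ucp)
    show "T > 0" by fact
    show "mild_on R (\<lambda>t. exp (\<nu> j * t) *\<^sub>R p j) z T"
      using insert.prems(8) insert.hyps zero by simp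
    show "C (z t) = exp (\<nu> j * t) *\<^sub>R q j" if "t \<in> {0<..<T}" for t
      using insert.prems(9)[OF that] insert.hyps zero by simp
    show "a = 0" if "generator R a = Some (p j - \<nu> j *\<^sub>R a)" "C a = q j" for a
      using insert.prems(7)[OF _ that(1), of j] that insert.prems(5,6)[of j] by simp
  qed
  with zero show ?case by simp
qed

text \<open>
  Since each \<open>V k\<close> is a subspace, all spanning functions with the same index \<open>k\<close> can be
  collected in one coefficient.
\<close>

lemma exp_span_representation:
  assumes w: "w \<in> exp_span T N m V" and V: "\<And>k. k \<in> {1..N} \<Longrightarrow> subspace (V k)"
  obtains v where "\<And>k. k \<in> {1..N} \<Longrightarrow> v k \<in> V k"
    and "w = (\<lambda>t. if t \<in> {0<..<T} then \<Sum>k\<in>{1..N}. exp (m k * t) *\<^sub>R v k else 0)"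
proof -
  interpret M: module "scale_fun :: real \<Rightarrow> (real \<Rightarrow> 'a) \<Rightarrow> real \<Rightarrow> 'a"
    by (rule module_scale_fun)
  have "\<exists>v. (\<forall>k\<in>{1..N}. v k \<in> V k) \<and>
    w = (\<lambda>t. if t \<in> {0<..<T} then \<Sum>k\<in>{1..N}. exp (m k * t) *\<^sub>R v k else 0)"
    using w unfolding exp_span_def
  proof (induction w rule: M.span_induct_alt)
    case base
    show ?case using V by (intro exI[of _ "\<lambda>_. 0"]) (auto simp: zero_fun_def subspace_0)
  next
    case (step c f w)
    then obtain v k x where v: "\<forall>k\<in>{1..N}. v k \<in> V k"
      "w = (\<lambda>t. if t \<in> {0<..<T} then \<Sum>k\<in>{1..N}. exp (m k * t) *\<^sub>R v k else 0)"
      and k: "k \<in> {1..N}" "x \<in> V k" "f = exp_fun T (m k) x" by blast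
    show ?case
    proof (intro exI[of _ "\<lambda>i. (if i = k then c *\<^sub>R x else 0) + v i"] conjI ballI ext)
      show "(if i = k then c *\<^sub>R x else 0) + v i \<in> V i" if "i \<in> {1..N}" for i
        using V[OF that] v k that by (auto intro: subspace_add subspace_scale)
      fix t
      have "(\<Sum>i\<in>{1..N}. exp (m i * t) *\<^sub>R (if i = k then c *\<^sub>R x else 0)) = c *\<^sub>R exp (m k * t) *\<^sub>R x"
        using k(1) by (subst sum.mono_neutral_right[of _ "{k}"]) auto
      then show "(scale_fun c f + w) t = (if t \<in> {0<..<T} then
          \<Sum>i\<in>{1..N}. exp (m i * t) *\<^sub>R ((if i = k then c *\<^sub>R x else 0) + v i) else 0)"
        by (auto simp: k(3) v(2) scale_fun_def exp_fun_def plus_fun_def scaleR_add_right sum.distrib)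
    qed
  qed
  with that show ?thesis by blast
qed

theorem theorem5p2:
  fixes A :: "'h::{real_inner,banach} \<rightharpoonup> 'h"
    and B :: "'u::{real_inner,banach} \<Rightarrow>\<^sub>L 'h"
    and T :: real
    and K J :: nat
    and \<mu> \<rho> :: "nat \<Rightarrow> real"
    and W :: "nat \<Rightarrow> 'h set"
    and G :: "nat \<Rightarrow> 'u set"
  assumes "generates_analytic_semigroup A"
    and "T > 0"
    and "inj_on \<mu> {1..K}"
    and "\<And>k. k \<in> {1..K} \<Longrightarrow> subspace (W k) \<and> closed (W k)"
    and "\<And>k z. \<lbrakk>k \<in> {1..K}; z \<in> dom (adjoint_op A);
            \<mu> k *\<^sub>R z + the (adjoint_op A z) \<in> W k;
            adjoint (blinfun_apply B) z = 0\<rbrakk> \<Longrightarrow> z = 0"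
    and "inj_on \<rho> {1..J}"
    and "\<And>j. j \<in> {1..J} \<Longrightarrow> subspace (G j) \<and> closed (G j)"
    and "\<And>j z. \<lbrakk>j \<in> {1..J}; z \<in> dom (adjoint_op A);
            \<rho> j *\<^sub>R z + the (adjoint_op A z) = 0;
            adjoint (blinfun_apply B) z \<in> G j\<rbrakk> \<Longrightarrow> z = 0"
    and "\<mu> ` {1..K} \<inter> \<rho> ` {1..J} = {}"
    and "\<And>zT z. \<lbrakk>backward_mild_solution (adjoint_op A) T zT (\<lambda>_. 0) z;
            \<forall>t\<in>{0<..<T}. adjoint (blinfun_apply B) (z t) = 0\<rbrakk> \<Longrightarrow> zT = 0"
  shows "\<forall>zT. \<forall>g\<in>exp_span T J \<rho> G. \<forall>w\<in>exp_span T K \<mu> W. \<forall>z.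
           backward_mild_solution (adjoint_op A) T zT w z \<and>
           (\<forall>t\<in>{0<..<T}. adjoint (blinfun_apply B) (z t) = g t)
           \<longrightarrow> zT = 0 \<and> g = 0 \<and> w = 0"
proof (intro allI ballI impI)
  fix zT g w z
  assume g: "g \<in> exp_span T J \<rho> G" and w: "w \<in> exp_span T K \<mu> W"
    and sol: "backward_mild_solution (adjoint_op A) T zT w z \<and>
           (\<forall>t\<in>{0<..<T}. adjoint (blinfun_apply B) (z t) = g t)"
  obtain S where S: "analytic_semigroup S" "generator S = A"
    using assms(1) unfolding generates_analytic_semigroup_def by blast
  obtain R where R: "c0_semigroup R" "generator R = adjoint_op A"
    and formula: "\<And>t. t \<in> {0..T} \<Longrightarrow> ((\<lambda>s. blinfun_apply (R (s - t)) (w s))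
            has_integral (blinfun_apply (R (T - t)) zT - z t)) {t..T}"
    using sol unfolding backward_mild_solution_def by blast
  obtain p where p: "\<And>k. k \<in> {1..K} \<Longrightarrow> p k \<in> W k"
    "w = (\<lambda>t. if t \<in> {0<..<T} then \<Sum>k\<in>{1..K}. exp (\<mu> k * t) *\<^sub>R p k else 0)"
    using exp_span_representation[OF w] assms(4) by blast
  obtain q where q: "\<And>j. j \<in> {1..J} \<Longrightarrow> q j \<in> G j"
    "g = (\<lambda>t. if t \<in> {0<..<T} then \<Sum>j\<in>{1..J}. exp (\<rho> j * t) *\<^sub>R q j else 0)"
    using exp_span_representation[OF g] assms(7) by blast
  \<comment> \<open>both families of exponents in one family indexed by a disjoint sum; a \<open>\<mu>\<close>-exponent has the
    coefficient \<open>0\<close> in \<open>g\<close>, and a \<open>\<rho>\<close>-exponent has the coefficient \<open>0\<close> in \<open>w\<close>\<close>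
  define I where "I = {1..K} <+> {1..J}"
  define \<nu> where "\<nu> = case_sum \<mu> \<rho>"
  define p' :: "nat + nat \<Rightarrow> 'h" where "p' = case_sum p (\<lambda>_. 0)"
  define q' :: "nat + nat \<Rightarrow> 'u" where "q' = case_sum (\<lambda>_. 0) q"
  have sum_I: "(\<Sum>i\<in>I. exp (\<nu> i * t) *\<^sub>R p' i) = (\<Sum>k\<in>{1..K}. exp (\<mu> k * t) *\<^sub>R p k)"
    "(\<Sum>i\<in>I. exp (\<nu> i * t) *\<^sub>R q' i) = (\<Sum>j\<in>{1..J}. exp (\<rho> j * t) *\<^sub>R q j)" for t
    by (simp_all add: I_def \<nu>_def p'_def q'_def sum.Plus)
  have "\<forall>i\<in>I. p' i = 0 \<and> q' i = 0"
  proof (rule exponential_sum_vanishes[where \<nu> = \<nu> and T = T and z = z and p = p' and q = q'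
        and V = "case_sum W (\<lambda>_. {0})" and X = "case_sum (\<lambda>_. {0}) G",
        OF R(1) linear_adjoint_blinfun[of B]])
    show "y = 0" if "\<tau> > 0" and zero: "\<And>t. 0 < t \<Longrightarrow> t < \<tau> \<Longrightarrow> adjoint (blinfun_apply B) (blinfun_apply (R t) y) = 0"
      for \<tau> y
    proof (rule unique_continuation_short_time[where T = T and B = B, OF S(1) R(1) _ _ that(1)])
      show "generator R = adjoint_op (generator S)" by (simp only: R(2) S(2))
      show "zT = 0" if "backward_mild_solution (generator R) T zT (\<lambda>_. 0) z"
        "\<forall>t\<in>{0<..<T}. adjoint (blinfun_apply B) (z t) = 0" for zT z
        using assms(10) that unfolding R(2) by blast
      show "adjoint (blinfun_apply B) (blinfun_apply (R t) y) = 0" if "0 < t" "t < \<tau>" for t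
        using that by (rule zero)
    qed
    show "finite I" by (simp add: I_def)
    have disjoint: "\<mu> k \<noteq> \<rho> j" if "k \<in> {1..K}" "j \<in> {1..J}" for k j
      using assms(9) that by blast
    show "inj_on \<nu> I"
    proof (rule inj_onI)
      fix i i' assume ii': "i \<in> I" "i' \<in> I" "\<nu> i = \<nu> i'"
      then show "i = i'"
        using inj_onD[OF assms(3)] inj_onD[OF assms(6)] disjoint disjoint[symmetric]
        unfolding I_def \<nu>_def by (elim PlusE) fastforce+
    qed
    show "mild_on R (\<lambda>t. \<Sum>i\<in>I. exp (\<nu> i * t) *\<^sub>R p' i) z T"
      by (rule mild_on_cong[OF mild_on_if_terminal_formula[OF R(1) formula]]) (auto simp: p(2) sum_I)
    show "adjoint (blinfun_apply B) (z t) = (\<Sum>i\<in>I. exp (\<nu> i * t) *\<^sub>R q' i)" if "t \<in> {0<..<T}" for t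
      using sol that by (simp add: sum_I q(2))
    show "subspace (case_sum W (\<lambda>_. {0}) i)" "subspace (case_sum (\<lambda>_. {0}) G i)"
      "p' i \<in> case_sum W (\<lambda>_. {0}) i" "q' i \<in> case_sum (\<lambda>_. {0}) G i" if "i \<in> I" for i
      using that assms(4,7) p(1) q(1) by (auto simp: I_def p'_def q'_def subspace_single_0)
    show "a = 0" if "i \<in> I" "generator R a = Some b"
      "\<nu> i *\<^sub>R a + b \<in> case_sum W (\<lambda>_. {0}) i" "adjoint (blinfun_apply B) a \<in> case_sum (\<lambda>_. {0}) G i" for i a b
    proof (cases i)
      case (Inl k)
      then show ?thesis using that assms(5)[of k a] R(2) by (auto simp: I_def \<nu>_def domI)
    next
      case (Inr j)
      then show ?thesis using that assms(8)[of j a] R(2) by (auto simp: I_def \<nu>_def domI)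
    qed
  qed (rule assms(2))
  then have "p k = 0" if "k \<in> {1..K}" for k
    using that by (auto simp: I_def p'_def dest!: bspec[of _ _ "Inl k"])
  then have w0: "w = (\<lambda>_. 0)" by (auto simp: p(2))
  have "q j = 0" if "j \<in> {1..J}" for j
    using that \<open>\<forall>i\<in>I. _\<close> by (auto simp: I_def q'_def dest!: bspec[of _ _ "Inr j"])
  then have g0: "g = (\<lambda>_. 0)" by (auto simp: q(2))
  have "zT = 0" using assms(10)[of zT z] sol by (simp add: w0 g0)
  then show "zT = 0 \<and> g = 0 \<and> w = 0" by (simp add: w0 g0 zero_fun_def)
qed

end
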